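(* Let $n\ge 4$ be an integer with $n\equiv 0$ or $1\pmod 4$. For every $\xi\in\mathcal{D}(\mathcal{S}_n)$, the number $lsc(n;\xi)$ of labelled self-complementary graphs $G$ of order $n$ with $|\Gamma(G)|=\xi$ satisfies $$lsc(n;\xi)=|\mathcal{L}_\xi(\mathcal{S}_n)|.$$
   Context: Let $V=\{1,\dots,n\}$ and let $\binom{V}{2}$ be the set of 2-element subsets of $V$; write $ij$ for $\{i,j\}$ with $i<j$. A labelled graph of order $n$ is a pair $G=(V,E)$ with $E\subseteq\binom{V}{2}$; $\overline{G}=(V,\binom{V}{2}\setminus E)$ is its complement. Let $A$ be the symmetric group on $V$. For $\alpha\in A$, $\alpha G$ is the graph on $V$ with edge-set $\{\{\alpha i,\alpha j\}: ij\in E\}$, and $\alpha'$ is the permutation of $\binom{V}{2}$ given by $\alpha'\{i,j\}=\{\alpha i,\alpha j\}$. $\Gamma(G)=\{\alpha\in A:\alpha G=G\}$ is the automorphism group of $G$. $Z(\alpha')$ denotes the set of all cycles (including cycles of length 1) in the disjoint cycle decomposition of $\alpha'$. $G$ is self-complementary if $\alpha G=\overline{G}$ for some $\alpha\in A$; $\mathcal{S}_n$ is the set of all self-complementary labelled graphs on $V$. Put $A_S=\{\alpha\in A:\exists G\in\mathcal{S}_n,\ \alpha G=\overline{G}\}$. Let $\lambda=\binom{n}{2}$, and for $ij\in\binom{V}{2}$ ($i<j$) let $p_{ij}=\frac{(2n-i)(i-1)}{2}+(j-i)$ and $w(ij)=2^{\lambda-p_{ij}}$; $w$ is a bijection from $\binom{V}{2}$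 onto $\{2^0,2^1,\dots,2^{\lambda-1}\}$. For $\alpha\in A_S$, every cycle $z\in Z(\alpha')$ has even length. Write $z=(i_1j_1,i_2j_2,\dots,i_kj_k)$, starting with the element of $z$ at which $w$ is largest, and let $P_1(z)=\{i_1j_1,i_3j_3,\dots,i_{k-1}j_{k-1}\}$ and $P_2(z)=\{i_2j_2,i_4j_4,\dots,i_kj_k\}$. Put $W_1(z)=\sum_{ij\in P_1(z)}w(ij)$, $W_2(z)=\sum_{ij\in P_2(z)}w(ij)$, and define the polynomials $$U_\alpha^{(n)}(x)=\prod_{z\in Z(\alpha')}\bigl(x^{W_1(z)}+x^{W_2(z)}\bigr),\qquad U^{(n)}(x)=\sum_{\alpha\in A_S}U_\alpha^{(n)}(x).$$ Let $d_L$ be the coefficient of $x^L$ in $U^{(n)}(x)$. Put $\mathcal{D}(\mathcal{S}_n)=\{d_L: L\ge 0,\ d_L\ne 0\}$, and for a positive integer $\xi$ put $\mathcal{L}_\xi(\mathcal{S}_n)=\{L: d_L=\xi\}$. *)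

theory Defs
  imports
    "HOL-Combinatorics.Combinatorics"
    "HOL-Computational_Algebra.Polynomial"
    "HOL-Library.Ramsey"
begin

section \<open>Labelled graphs on \<open>{1..n}\<close>\<close>

definition verts :: "nat \<Rightarrow> nat set"
  where "verts n = {1..n}"

definition pairs :: "nat \<Rightarrow> nat set set"
  where "pairs n = nsets (verts n) 2"

type_synonym lgraph = "nat set \<times> nat set set"

definition lgraphs :: "nat \<Rightarrow> lgraph set"
  where "lgraphs n = {(verts n, E) | E. E \<subseteq> pairs n}"

definition complement :: "lgraph \<Rightarrow> lgraph"
  where "complement G = (fst G, nsets (fst G) 2 - snd G)"

definition sym_grp :: "nat \<Rightarrow> (nat \<Rightarrow> nat) set"
  where "sym_grp n = {\<alpha>. \<alpha> permutes verts n}"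

definition act :: "(nat \<Rightarrow> nat) \<Rightarrow> lgraph \<Rightarrow> lgraph"
  where "act \<alpha> G = (fst G, {{\<alpha> i, \<alpha> j} | i j. {i, j} \<in> snd G})"

definition aut_grp :: "nat \<Rightarrow> lgraph \<Rightarrow> (nat \<Rightarrow> nat) set"
  where "aut_grp n G = {\<alpha> \<in> sym_grp n. act \<alpha> G = G}"

definition sc_graphs :: "nat \<Rightarrow> lgraph set"
  where "sc_graphs n = {G \<in> lgraphs n. \<exists>\<alpha> \<in> sym_grp n. act \<alpha> G = complement G}"

definition sc_perms :: "nat \<Rightarrow> (nat \<Rightarrow> nat) set"
  where "sc_perms n = {\<alpha> \<in> sym_grp n. \<exists>G \<in> sc_graphs n. act \<alpha> G = complement G}"

definition lsc :: "nat \<Rightarrow> nat \<Rightarrow> nat"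
  where "lsc n \<xi> = card {G \<in> sc_graphs n. card (aut_grp n G) = \<xi>}"


section \<open>Weights of pairs\<close>

text \<open>The numerator \<open>(2 * n - i) * (i - 1)\<close> is always even and no subtraction truncates for
  \<open>1 \<le> i < j \<le> n\<close>; \<open>pos n i j\<close> is the rank of \<open>{i, j}\<close> in the lexicographic order, from \<open>1\<close> up to
  \<open>n choose 2\<close>.\<close>

definition pos :: "nat \<Rightarrow> nat \<Rightarrow> nat \<Rightarrow> nat"
  where "pos n i j = (2 * n - i) * (i - 1) div 2 + (j - i)"

definition weight :: "nat \<Rightarrow> nat set \<Rightarrow> nat"
  where "weight n e = 2 ^ ((n choose 2) - pos n (Min e) (Max e))"


section \<open>Cycles of the induced permutation of pairs\<close>

text \<open>Extended by the identity outside \<open>pairs n\<close>, as usual for \<^const>\<open>permutes\<close>.\<close>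

definition pair_perm :: "nat \<Rightarrow> (nat \<Rightarrow> nat) \<Rightarrow> nat set \<Rightarrow> nat set"
  where "pair_perm n \<alpha> e = (if e \<in> pairs n then \<alpha> ` e else e)"

text \<open>\<^term>\<open>support p e\<close> is the list \<open>[e, p e, p (p e), \<dots>]\<close> running once through the cycle of \<open>e\<close>.
  Since \<^term>\<open>weight n\<close> is injective on \<^term>\<open>pairs n\<close>, requiring the first entry to have the largest
  weight selects exactly one list for every cycle (fixed points included).\<close>

definition cycles_of :: "nat \<Rightarrow> (nat \<Rightarrow> nat) \<Rightarrow> nat set list set"
  where "cycles_of n \<alpha> =
    {support (pair_perm n \<alpha>) e | e.
       e \<in> pairs n \<and> (\<forall>f \<in> set (support (pair_perm n \<alpha>) e). weight n f \<le> weight n e)}"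

text \<open>List positions start at \<open>0\<close>, so the first, third, fifth entries and so on are those at even positions.\<close>

definition P1 :: "nat set list \<Rightarrow> nat set set"
  where "P1 z = {z ! k | k. k < length z \<and> even k}"

definition P2 :: "nat set list \<Rightarrow> nat set set"
  where "P2 z = {z ! k | k. k < length z \<and> odd k}"

definition W1 :: "nat \<Rightarrow> nat set list \<Rightarrow> nat"
  where "W1 n z = (\<Sum>e \<in> P1 z. weight n e)"

definition W2 :: "nat \<Rightarrow> nat set list \<Rightarrow> nat"
  where "W2 n z = (\<Sum>e \<in> P2 z. weight n e)"


section \<open>The polynomials and their coefficients\<close>

definition U_perm :: "nat \<Rightarrow> (nat \<Rightarrow> nat) \<Rightarrow> nat poly"
  where "U_perm n \<alpha> = (\<Prod>z \<in> cycles_of n \<alpha>. monom 1 (W1 n z) + monom 1 (W2 n z))"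

definition U :: "nat \<Rightarrow> nat poly"
  where "U n = (\<Sum>\<alpha> \<in> sc_perms n. U_perm n \<alpha>)"

definition coeff_values :: "nat \<Rightarrow> nat set"
  where "coeff_values n = {coeff (U n) L | L. coeff (U n) L \<noteq> 0}"

definition levels :: "nat \<Rightarrow> nat \<Rightarrow> nat set"
  where "levels n \<xi> = {L. coeff (U n) L = \<xi>}"

end

theory Submission
  imports Defs "HOL-Library.Nat_Bijection"
begin

text \<open>
  Identify a labelled graph with its edge set \<open>E\<close>. As the weights are distinct powers of two, \<open>E\<close> is
  determined by its total weight. A permutation \<open>\<alpha>\<close> maps \<open>E\<close> to its complement iff \<open>E\<close> alternates
  along every cycle \<open>z\<close> of the induced permutation of pairs, that is, meets \<open>z\<close> in exactly \<open>P1 z\<close> or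
  exactly \<open>P2 z\<close>. Expanding the product, \<open>U_perm n \<alpha>\<close> is therefore the generating function by weight
  of the graphs that \<open>\<alpha>\<close> complements. Summed over \<open>\<alpha>\<close>, the coefficient at the weight of \<open>E\<close> counts the
  permutations complementing \<open>E\<close>; they form a coset of the automorphism group if there are any.
\<close>

section \<open>Expanding a product of binomials over disjoint blocks\<close>

text \<open>Expanding means choosing \<open>A z\<close> or \<open>B z\<close> in every block. The
  blocks are disjoint, so the exponents of a choice add up to the weight of the union of the chosen
  sets. By \<open>AB\<close> and \<open>ne\<close> the two options of a block differ, so distinct
  choices give distinct sets \<open>E\<close>.\<close>

lemma prod_monom_add_eq_sum_sets:
  fixes w :: "'a \<Rightarrow> nat" and A B :: "'c \<Rightarrow> 'a set"
  assumes finC: "finite C" and finX: "finite X"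
    and X: "X = (\<Union>z\<in>C. A z \<union> B z)"
    and disj: "\<And>z z'. z \<in> C \<Longrightarrow> z' \<in> C \<Longrightarrow> z \<noteq> z' \<Longrightarrow> (A z \<union> B z) \<inter> (A z' \<union> B z') = {}"
    and AB: "\<And>z. z \<in> C \<Longrightarrow> A z \<inter> B z = {}"
    and ne: "\<And>z. z \<in> C \<Longrightarrow> A z \<noteq> {}"
  shows "(\<Prod>z\<in>C. monom (1::nat) (sum w (A z)) + monom 1 (sum w (B z))) =
    (\<Sum>E | E \<subseteq> X \<and> (\<forall>z\<in>C. E \<inter> (A z \<union> B z) = A z \<or> E \<inter> (A z \<union> B z) = B z). monom 1 (sum w E))"
proof -
  \<comment> \<open>A choice is encoded by the set \<open>S\<close> of blocks in which
    \<open>A z\<close> is taken; \<open>F S\<close> is the set it assembles.\<close>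
  define F where "F S = (\<Union>z\<in>C. if z \<in> S then A z else B z)" for S
  have monom_prod: "(\<Prod>z\<in>S. monom (1::nat) (f z)) = monom 1 (sum f S)" if "finite S" for S and f :: "'c \<Rightarrow> nat"
    using that by (induction S rule: finite_induct) (auto simp: mult_monom monom_0 one_pCons)
  have fin: "finite (A z)" "finite (B z)" if "z \<in> C" for z
    using that by (auto simp: X intro!: finite_subset[OF _ finX])
  have restr: "F S \<inter> (A z \<union> B z) = (if z \<in> S then A z else B z)" if z: "z \<in> C" for S z
  proof
    show "F S \<inter> (A z \<union> B z) \<subseteq> (if z \<in> S then A z else B z)"
    proof
      fix x assume x: "x \<in> F S \<inter> (A z \<union> B z)"
      then obtain z' where z': "z' \<in> C" "x \<in> (if z' \<in> S then A z' else B z')"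
        by (auto simp: F_def)
      then have "x \<in> A z' \<union> B z'" by (auto split: if_splits)
      then have "z' = z" using disj[OF z'(1) z] x by blast
      then show "x \<in> (if z \<in> S then A z else B z)" using z'(2) by blast
    qed
  qed (use z in \<open>auto simp: F_def\<close>)
  have weight: "(\<Prod>z\<in>S. monom 1 (sum w (A z))) * (\<Prod>z\<in>C - S. monom 1 (sum w (B z))) = monom (1::nat) (sum w (F S))"
    if S: "S \<subseteq> C" for S
  proof -
    have "sum w (F S) = (\<Sum>z\<in>C. sum w (if z \<in> S then A z else B z))"
      unfolding F_def
    proof (rule sum.UNION_disjoint[OF finC])
      show "\<forall>i\<in>C. \<forall>j\<in>C. i \<noteq> j \<longrightarrow> (if i \<in> S then A i else B i) \<inter> (if j \<in> S then A j else B j) = {}"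
      proof (intro ballI impI)
        fix i j assume "i \<in> C" "j \<in> C" "i \<noteq> j"
        from disj[OF this] show "(if i \<in> S then A i else B i) \<inter> (if j \<in> S then A j else B j) = {}"
          by auto
      qed
    qed (use fin in auto)
    also have "\<dots> = (\<Sum>z\<in>S. sum w (A z)) + (\<Sum>z\<in>C - S. sum w (B z))"
      using sum.subset_diff[OF S finC, of "\<lambda>z. sum w (if z \<in> S then A z else B z)"]
      by (simp add: add.commute)
    finally show ?thesis
      using S finC by (simp add: monom_prod finite_subset mult_monom del: One_nat_def)
  qed
  have "(\<Prod>z\<in>C. monom (1::nat) (sum w (A z)) + monom 1 (sum w (B z))) =
      (\<Sum>S\<in>Pow C. (\<Prod>z\<in>S. monom 1 (sum w (A z))) * (\<Prod>z\<in>C - S. monom 1 (sum w (B z))))"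
    by (rule prod_add[OF finC])
  also have "\<dots> = (\<Sum>E | E \<subseteq> X \<and> (\<forall>z\<in>C. E \<inter> (A z \<union> B z) = A z \<or> E \<inter> (A z \<union> B z) = B z). monom 1 (sum w E))"
  \<comment> \<open>The inverse of \<open>F\<close> reads off from \<open>E\<close> the blocks that
    it meets in \<open>A z\<close>.\<close>
  proof (rule sum.reindex_bij_witness[where j = F and i = "\<lambda>E. {z\<in>C. E \<inter> (A z \<union> B z) = A z}"])
    fix S assume S: "S \<in> Pow C"
    have AneB: "A z \<noteq> B z" if "z \<in> C" for z
      using AB[OF that] ne[OF that] by auto
    show "{z \<in> C. F S \<inter> (A z \<union> B z) = A z} = S"
    proof -
      have "F S \<inter> (A z \<union> B z) = A z \<longleftrightarrow> z \<in> S" if "z \<in> C" for z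
        using restr[OF that, of S] AneB[OF that] by auto
      then show ?thesis using S by blast
    qed
    show "F S \<in> {E. E \<subseteq> X \<and> (\<forall>z\<in>C. E \<inter> (A z \<union> B z) = A z \<or> E \<inter> (A z \<union> B z) = B z)}"
      using restr[of _ S] by (auto simp: F_def X split: if_splits)
    show "monom (1::nat) (sum w (F S)) = (\<Prod>z\<in>S. monom 1 (sum w (A z))) * (\<Prod>z\<in>C - S. monom 1 (sum w (B z)))"
      using weight S by simp
  next
    fix E assume E: "E \<in> {E. E \<subseteq> X \<and> (\<forall>z\<in>C. E \<inter> (A z \<union> B z) = A z \<or> E \<inter> (A z \<union> B z) = B z)}"
    let ?S = "{z \<in> C. E \<inter> (A z \<union> B z) = A z}"
    \<comment> \<open>Outside \<open>?S\<close> the condition on \<open>E\<close> leaves only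
      \<open>B z\<close> as its trace on the block.\<close>
    have "F ?S = (\<Union>z\<in>C. E \<inter> (A z \<union> B z))"
      unfolding F_def using E by (intro SUP_cong) auto
    also have "\<dots> = E" using E unfolding X by blast
    finally show "F ?S = E" .
  qed auto
  finally show ?thesis .
qed

section \<open>Pairs, their lexicographic rank and their weight\<close>

lemma finite_verts_pairs [simp]: "finite (verts n)" "finite (pairs n)"
  by (auto simp: verts_def pairs_def nsets_def)

lemma pairsE:
  assumes "e \<in> pairs n"
  obtains i j where "e = {i, j}" "1 \<le> i" "i < j" "j \<le> n"
proof -
  from assms obtain x y where "e = {x, y}" "x \<in> verts n" "y \<in> verts n" "x \<noteq> y"
    unfolding pairs_def by (rule nsets2_E)
  then show ?thesis using that[of "min x y" "max x y"]
    by (cases "x < y") (auto simp: verts_def insert_commute min_def max_def)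
qed

text \<open>The offset \<open>(2 * n - i) * (i - 1) div 2\<close> counts the pairs whose smaller
  element is below \<open>i\<close>. The pairs with smaller element \<open>i\<close> take up the
  next \<open>n - i\<close> ranks, ending at the offset of \<open>Suc i\<close>.\<close>

lemma pos_bounds:
  assumes "1 \<le> i" "i < j" "j \<le> n"
  shows "(2 * n - i) * (i - 1) div 2 < pos n i j"
    and "pos n i j \<le> (2 * n - Suc i) * i div 2"
proof -
  obtain k d where "i = Suc k" "n = i + d"
    using assms by (metis Suc_le_D less_imp_le le_trans One_nat_def le_iff_add)
  \<comment> \<open>The two numerators differ by an even number, so their halves differ by exactly
    \<open>n - i\<close>, whatever their parity.\<close>
  then have "(2 * n - Suc i) * i = (2 * n - i) * (i - 1) + 2 * (n - i)"
    by (simp add: algebra_simps)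
  then have "(2 * n - Suc i) * i div 2 = (2 * n - i) * (i - 1) div 2 + (n - i)"
    by simp
  moreover have "0 < j - i" "j - i \<le> n - i" using assms by auto
  ultimately show "(2 * n - i) * (i - 1) div 2 < pos n i j"
    and "pos n i j \<le> (2 * n - Suc i) * i div 2"
    unfolding pos_def by (metis less_add_same_cancel1, metis add_le_cancel_left)
qed

lemma pos_offset_mono:
  assumes "1 \<le> i" "i \<le> j" "j \<le> (n::nat)"
  shows "(2 * n - i) * (i - 1) div 2 \<le> (2 * n - j) * (j - 1) div 2"
  using assms(2,1,3)
proof (induction rule: dec_induct)
  case (step m)
  then have "m < Suc m" "1 \<le> m" "Suc m \<le> n" by auto
  \<comment> \<open>The rank of \<open>{m, Suc m}\<close> lies between the offsets of
    \<open>m\<close> and \<open>Suc m\<close>.\<close>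
  with pos_bounds[of m "Suc m" n] step show ?case by simp
qed simp

lemma pos_le:
  assumes "1 \<le> i" "i < j" "j \<le> n"
  shows "pos n i j \<le> n choose 2"
proof -
  have "pos n i j \<le> (2 * n - Suc i) * (Suc i - 1) div 2"
    using pos_bounds(2)[OF assms] by simp
  \<comment> \<open>No pair has \<open>n\<close> as its smaller element, so the offset of
    \<open>n\<close> already counts all pairs.\<close>
  also have "\<dots> \<le> (2 * n - n) * (n - 1) div 2"
    using assms by (intro pos_offset_mono) auto
  finally show ?thesis by (simp add: choose_two)
qed

text \<open>Different smaller elements own disjoint intervals of ranks, so the rank determines
  \<open>i\<close>; then \<open>j\<close> follows from the remaining summand.\<close>

lemma pos_inj:
  assumes "1 \<le> i" "i < j" "j \<le> n" "1 \<le> i'" "i' < j'" "j' \<le> n" "pos n i j = pos n i' j'"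
  shows "i = i' \<and> j = j'"
proof -
  have less: "pos n a b < pos n a' b'" if "1 \<le> a" "a < b" "b \<le> n" "a' < b'" "b' \<le> n" "a < a'" for a b a' b'
  proof -
    have "pos n a b \<le> (2 * n - Suc a) * (Suc a - 1) div 2"
      using pos_bounds(2)[of a b n] that by simp
    also have "\<dots> \<le> (2 * n - a') * (a' - 1) div 2"
      using that by (intro pos_offset_mono) auto
    also have "\<dots> < pos n a' b'"
      using that by (intro pos_bounds(1)) auto
    finally show ?thesis .
  qed
  have "i = i'"
    using less[of i j i' j'] less[of i' j' i j] assms by (metis less_irrefl linorder_neqE_nat)
  then show ?thesis using assms by (auto simp: pos_def)
qed

lemma inj_on_weight_exponent:
  "inj_on (\<lambda>e. (n choose 2) - pos n (Min e) (Max e)) (pairs n)"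
proof (rule inj_onI)
  fix e f assume "e \<in> pairs n" "f \<in> pairs n"
    and eq: "(n choose 2) - pos n (Min e) (Max e) = (n choose 2) - pos n (Min f) (Max f)"
  then obtain i j i' j' where e: "e = {i, j}" "1 \<le> i" "i < j" "j \<le> n"
    and f: "f = {i', j'}" "1 \<le> i'" "i' < j'" "j' \<le> n"
    by (metis pairsE)
  \<comment> \<open>By \<open>pos_le\<close> neither subtraction truncates, so equal exponents do
    come from equal ranks.\<close>
  have "pos n i j = pos n i' j'"
    using eq e f pos_le[of i j n] pos_le[of i' j' n] by (simp add: max_def min_def)
  then show "e = f" using pos_inj e f by metis
qed

text \<open>The total weight is the number whose binary digits mark the exponents of the members,
  which is \<open>set_encode\<close>. Uniqueness of binary expansions recovers the exponents, and
  these recover the pairs.\<close>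

lemma inj_on_sum_weight: "inj_on (sum (weight n)) (Pow (pairs n))"
proof (rule inj_onI)
  fix D E assume DE: "D \<in> Pow (pairs n)" "E \<in> Pow (pairs n)" and eq: "sum (weight n) D = sum (weight n) E"
  let ?x = "\<lambda>e. (n choose 2) - pos n (Min e) (Max e)"
  have *: "sum (weight n) D = set_encode (?x ` D)" if "D \<subseteq> pairs n" for D
    unfolding set_encode_def weight_def
    using that by (subst sum.reindex) (auto intro: inj_on_subset[OF inj_on_weight_exponent])
  have fin: "finite D" "finite E" using DE by (auto intro: finite_subset)
  have "?x ` D = ?x ` E"
    using eq DE fin by (simp add: * set_encode_eq)
  then show "D = E"
    using inj_on_image_eq_iff[OF inj_on_weight_exponent] DE by blast
qed

lemma inj_on_weight: "inj_on (weight n) (pairs n)"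
proof (rule inj_onI)
  fix e f assume ef: "e \<in> pairs n" "f \<in> pairs n" and "weight n e = weight n f"
  then have "(n choose 2) - pos n (Min e) (Max e) = (n choose 2) - pos n (Min f) (Max f)"
    unfolding weight_def by (simp only: power_inject_exp one_less_numeral_iff semiring_norm)
  then show "e = f" by (rule inj_onD[OF inj_on_weight_exponent _ ef])
qed

section \<open>The action on pairs and on graphs\<close>

lemma image_mem_pairs:
  assumes "\<alpha> permutes verts n" "e \<in> pairs n"
  shows "\<alpha> ` e \<in> pairs n"
proof -
  have "card (\<alpha> ` e) = card e"
    using permutes_inj_on[OF assms(1)] by (rule card_image)
  moreover have "\<alpha> ` e \<subseteq> verts n"
    using assms permutes_image[OF assms(1)] by (auto simp: pairs_def nsets_def)
  ultimately show ?thesis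
    using assms(2) by (simp add: pairs_def nsets_def)
qed

lemma pair_perm_permutes:
  assumes "\<alpha> permutes verts n"
  shows "pair_perm n \<alpha> permutes pairs n"
proof (rule bij_imp_permutes)
  have "inj_on (pair_perm n \<alpha>) (pairs n)"
    using permutes_inj[OF assms] by (auto simp: inj_on_def pair_perm_def inj_image_eq_iff)
  moreover have "pair_perm n \<alpha> ` pairs n \<subseteq> pairs n"
    using image_mem_pairs[OF assms] by (auto simp: pair_perm_def)
  ultimately show "bij_betw (pair_perm n \<alpha>) (pairs n) (pairs n)"
    by (simp add: bij_betw_def endo_inj_surj)
qed (simp add: pair_perm_def)

lemma act_eq:
  assumes "E \<subseteq> pairs n"
  shows "act \<alpha> (V, E) = (V, (`) \<alpha> ` E)"
proof -
  have "{{\<alpha> i, \<alpha> j} | i j. {i, j} \<in> E} = (`) \<alpha> ` E"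
  proof (intro equalityI subsetI)
    fix x assume "x \<in> {{\<alpha> i, \<alpha> j} | i j. {i, j} \<in> E}"
    then obtain i j where "x = \<alpha> ` {i, j}" "{i, j} \<in> E" by auto
    then show "x \<in> (`) \<alpha> ` E" by blast
  next
    fix x assume "x \<in> (`) \<alpha> ` E"
    then obtain e where e: "e \<in> E" "x = \<alpha> ` e" by blast
    with assms have "e \<in> pairs n" by blast
    then obtain i j where "e = {i, j}" by (rule pairsE)
    then show "x \<in> {{\<alpha> i, \<alpha> j} | i j. {i, j} \<in> E}" using e by auto
  qed
  then show ?thesis by (simp add: act_def)
qed

lemma act_comp:
  assumes "E \<subseteq> pairs n" "\<beta> permutes verts n"
  shows "act (\<alpha> \<circ> \<beta>) (V, E) = act \<alpha> (act \<beta> (V, E))"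
proof -
  have "(`) \<beta> ` E \<subseteq> pairs n" using assms image_mem_pairs by blast
  then show ?thesis using assms(1) by (simp add: act_eq image_comp image_image)
qed

text \<open>This turns an equation between graphs into a condition on single pairs, which can be
  checked cycle by cycle. As \<open>?p\<close> permutes the pairs, membership may be tested at
  \<open>?p e\<close> instead of \<open>f\<close>, and injectivity cancels
  \<open>?p\<close>.\<close>

lemma act_eq_complement_iff:
  assumes \<alpha>: "\<alpha> permutes verts n" and E: "E \<subseteq> pairs n"
  shows "act \<alpha> (verts n, E) = complement (verts n, E) \<longleftrightarrow>
    (\<forall>e\<in>pairs n. pair_perm n \<alpha> e \<in> E \<longleftrightarrow> e \<notin> E)"
proof -
  let ?p = "pair_perm n \<alpha>"
  note p = pair_perm_permutes[OF \<alpha>]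
  have "(`) \<alpha> ` E = ?p ` E"
    using E by (intro image_cong) (auto simp: pair_perm_def)
  then have "act \<alpha> (verts n, E) = complement (verts n, E) \<longleftrightarrow> ?p ` E = pairs n - E"
    by (simp add: act_eq[OF E] complement_def pairs_def)
  also have "\<dots> \<longleftrightarrow> (\<forall>f\<in>pairs n. f \<in> ?p ` E \<longleftrightarrow> f \<notin> E)"
    using permutes_image[OF p] E by blast
  also have "\<dots> \<longleftrightarrow> (\<forall>e\<in>pairs n. ?p e \<in> ?p ` E \<longleftrightarrow> ?p e \<notin> E)"
    by (subst (1) permutes_image[OF p, symmetric]) simp
  also have "\<dots> \<longleftrightarrow> (\<forall>e\<in>pairs n. ?p e \<in> E \<longleftrightarrow> e \<notin> E)"
    using inj_image_mem_iff[OF permutes_inj[OF p]] by blast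
  finally show ?thesis .
qed

section \<open>Alternation along a cycle\<close>

lemma funpow_complementing:
  assumes p: "p permutes X" and E: "\<forall>x\<in>X. p x \<in> E \<longleftrightarrow> x \<notin> E" and "x \<in> X"
  shows "(p ^^ k) x \<in> E \<longleftrightarrow> (x \<in> E \<longleftrightarrow> even k)"
proof (induction k)
  case (Suc k)
  have "(p ^^ k) x \<in> X" using permutes_in_funpow_image[OF p] assms(3) by simp
  then show ?case using Suc E by auto
qed simp

lemma P1_support: "P1 (support p e) = {(p ^^ k) e | k. k < least_power p e \<and> even k}"
  by (force simp: P1_def)

lemma P2_support: "P2 (support p e) = {(p ^^ k) e | k. k < least_power p e \<and> odd k}"
  by (force simp: P2_def)

lemma P1_P2_set: "P1 z \<union> P2 z = set z"
  by (simp add: P1_def P2_def set_conv_nth) blast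

text \<open>The alternating set \<open>E\<close> separates the two halves: one of them lies inside
  \<open>E\<close> and the other outside.\<close>

lemma P1_P2_support_disjoint:
  assumes p: "p permutes X" and E: "\<forall>x\<in>X. p x \<in> E \<longleftrightarrow> x \<notin> E" and "x \<in> X"
  shows "P1 (support p x) \<inter> P2 (support p x) = {}"
  unfolding P1_support P2_support
  using funpow_complementing[OF p E assms(3)] by (smt (verit) disjoint_iff mem_Collect_eq)

text \<open>\<open>E0\<close> witnesses that some set alternates, which forces the cycle to have
  even length; \<open>E\<close> is arbitrary. On an even cycle the alternation closes up
  consistently, leaving only the choice whether \<open>x\<close> is in \<open>E\<close>.\<close>

lemma complementing_on_cycle_iff:
  assumes p: "p permutes X" and perm: "permutation p"
    and E0: "\<forall>x\<in>X. p x \<in> E0 \<longleftrightarrow> x \<notin> E0" and x: "x \<in> X"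
  shows "(\<forall>y\<in>set (support p x). p y \<in> E \<longleftrightarrow> y \<notin> E) \<longleftrightarrow>
    E \<inter> set (support p x) = P1 (support p x) \<or> E \<inter> set (support p x) = P2 (support p x)"
proof
  let ?z = "support p x" and ?l = "least_power p x"
  have l: "(p ^^ ?l) x = x" "?l > 0" using least_power_of_permutation[OF perm] by auto
  \<comment> \<open>Each step flips membership in \<open>E0\<close>, and after \<open>?l\<close>
    steps the walk is back at \<open>x\<close>.\<close>
  have "even ?l" using funpow_complementing[OF p E0 x, of ?l] l(1) by metis
  have mem: "(p ^^ k) x \<in> set ?z" for k using support_set[OF perm] by blast
  {
    assume L: "\<forall>y\<in>set ?z. p y \<in> E \<longleftrightarrow> y \<notin> E"
    have par: "(p ^^ k) x \<in> E \<longleftrightarrow> (x \<in> E \<longleftrightarrow> even k)" for k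
    proof (induction k)
      case (Suc k)
      have "p ((p ^^ k) x) \<in> E \<longleftrightarrow> (p ^^ k) x \<notin> E" using L mem[of k] by blast
      then show ?case using Suc by auto
    qed simp
    have "E \<inter> set ?z = {(p ^^ k) x | k. k < ?l \<and> (p ^^ k) x \<in> E}" by auto
    also have "\<dots> = {(p ^^ k) x | k. k < ?l \<and> (x \<in> E \<longleftrightarrow> even k)}" by (simp only: par)
    also have "\<dots> = (if x \<in> E then P1 ?z else P2 ?z)" by (simp add: P1_support P2_support)
    finally show "E \<inter> set ?z = P1 ?z \<or> E \<inter> set ?z = P2 ?z" by presburger
  next
    assume R: "E \<inter> set ?z = P1 ?z \<or> E \<inter> set ?z = P2 ?z"
    have dis: "P1 ?z \<inter> P2 ?z = {}" by (rule P1_P2_support_disjoint[OF p E0 x])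
    have step1: "p y \<in> P2 ?z" if "y \<in> P1 ?z" for y
    proof -
      from that obtain k where k: "y = (p ^^ k) x" "k < ?l" "even k" by (auto simp: P1_support)
      \<comment> \<open>An even \<open>k\<close> cannot be the last position of a cycle of even
        length.\<close>
      then have "Suc k < ?l" using \<open>even ?l\<close> by (metis Suc_lessI even_Suc)
      then show ?thesis using k unfolding P2_support
        by (intro CollectI exI[of _ "Suc k"]) auto
    qed
    have step2: "p y \<in> P1 ?z" if "y \<in> P2 ?z" for y
    proof -
      from that obtain k where k: "y = (p ^^ k) x" "k < ?l" "odd k" by (auto simp: P2_support)
      show ?thesis
      proof (cases "Suc k = ?l")
        \<comment> \<open>From the last position \<open>p\<close> wraps around to \<open>x\<close>,
          which sits at the even position 0.\<close>
        case True
        have "p y = (p ^^ Suc k) x" using k by simp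
        then have "p y = x" using True l by simp
        then show ?thesis using l unfolding P1_support by (intro CollectI exI[of _ 0]) auto
      next
        case False
        then show ?thesis using k unfolding P1_support
          by (intro CollectI exI[of _ "Suc k"]) auto
      qed
    qed
    show "\<forall>y\<in>set ?z. p y \<in> E \<longleftrightarrow> y \<notin> E"
      using R dis step1 step2 P1_P2_set[of ?z] by blast
  }
qed

section \<open>The polynomial of a single permutation\<close>

text \<open>The cycle lists partition the pairs into blocks with halves \<open>P1 z\<close> and
  \<open>P2 z\<close>, so the product expansion applies. Membership in \<open>sc_perms n\<close>
  supplies the alternating set \<open>E0\<close> that the cycle lemmas require.\<close>

lemma U_perm_eq_sum:
  assumes \<alpha>: "\<alpha> \<in> sc_perms n"
  shows "U_perm n \<alpha> = (\<Sum>E | E \<subseteq> pairs n \<and> act \<alpha> (verts n, E) = complement (verts n, E).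
    monom 1 (sum (weight n) E))"
proof -
  let ?p = "pair_perm n \<alpha>" and ?C = "cycles_of n \<alpha>"
  from \<alpha> have a: "\<alpha> permutes verts n" by (simp add: sc_perms_def sym_grp_def)
  note p = pair_perm_permutes[OF a]
  have perm: "permutation ?p" using p permutation_permutes by (meson finite_verts_pairs(2))
  from \<alpha> obtain E0 where "E0 \<subseteq> pairs n" "act \<alpha> (verts n, E0) = complement (verts n, E0)"
    by (auto simp: sc_perms_def sc_graphs_def lgraphs_def)
  then have E0: "\<forall>x\<in>pairs n. ?p x \<in> E0 \<longleftrightarrow> x \<notin> E0"
    using act_eq_complement_iff[OF a] by blast
  have self: "e \<in> set (support ?p e)" for e
    unfolding support_set[OF perm] by (metis funpow_0 rangeI)
  have sub: "set (support ?p e) \<subseteq> pairs n" if "e \<in> pairs n" for e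
    unfolding support_set[OF perm] using permutes_in_funpow_image[OF p that] by auto
  have same: "set (support ?p e) = set (support ?p f)" if "f \<in> set (support ?p e)" for e f
    using disjointD[OF disjoint_support[OF perm], of "set (support ?p e)" "set (support ?p f)"]
      self[of f] that by blast
  have C: "\<exists>e. e \<in> pairs n \<and> z = support ?p e \<and> (\<forall>f\<in>set z. weight n f \<le> weight n e)" if "z \<in> ?C" for z
    using that unfolding cycles_of_def by blast
  have finC: "finite ?C"
    by (rule finite_subset[of _ "support ?p ` pairs n"]) (auto simp: cycles_of_def)
  have union: "pairs n = (\<Union>z\<in>?C. P1 z \<union> P2 z)"
  proof (intro equalityI subsetI)
    \<comment> \<open>The list in \<open>cycles_of\<close> that contains \<open>x\<close> is
      obtained by restarting its cycle at the heaviest pair \<open>e\<close>.\<close>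
    fix x assume x: "x \<in> pairs n"
    let ?W = "weight n ` set (support ?p x)"
    have "Max ?W \<in> ?W" using self[of x]
      by (intro Max_in finite_imageI List.finite_set) (metis empty_iff image_is_empty)
    then obtain e where e: "e \<in> set (support ?p x)" "weight n e = Max ?W" by force
    have "weight n f \<le> weight n e" if "f \<in> set (support ?p x)" for f
      unfolding e(2) using that by (intro Max_ge finite_imageI List.finite_set) blast
    note e = e(1) this
    have "support ?p e \<in> ?C"
      unfolding cycles_of_def using e same[OF e(1)] sub[OF x] by blast
    moreover have "x \<in> set (support ?p e)" using same[OF e(1)] self[of x] by blast
    ultimately show "x \<in> (\<Union>z\<in>?C. P1 z \<union> P2 z)" unfolding P1_P2_set by blast
  next
    fix x assume "x \<in> (\<Union>z\<in>?C. P1 z \<union> P2 z)"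
    then show "x \<in> pairs n" unfolding P1_P2_set using C sub by blast
  qed
  have disj: "set z \<inter> set z' = {}" if z: "z \<in> ?C" "z' \<in> ?C" "z \<noteq> z'" for z z'
  proof (rule ccontr)
    assume "set z \<inter> set z' \<noteq> {}"
    then obtain f where f: "f \<in> set z" "f \<in> set z'" by blast
    obtain e where e: "e \<in> pairs n" "z = support ?p e" "\<forall>f\<in>set z. weight n f \<le> weight n e"
      using C[OF z(1)] by blast
    obtain e' where e': "e' \<in> pairs n" "z' = support ?p e'" "\<forall>f\<in>set z'. weight n f \<le> weight n e'"
      using C[OF z(2)] by blast
    have eq: "set z = set z'" using same f e(2) e'(2) by metis
    \<comment> \<open>Both lists run through the same cycle and start at a pair of maximal weight;
      injectivity of the weight makes the starting pairs equal.\<close>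
    have "weight n e = weight n e'"
      using e e' eq self by (metis order_antisym)
    then have "e = e'" using inj_onD[OF inj_on_weight] e e' by blast
    then show False using z e e' by blast
  qed
  have cyc: "P1 z \<inter> P2 z = {}" "P1 z \<noteq> {}"
    "(\<forall>y\<in>set z. ?p y \<in> E \<longleftrightarrow> y \<notin> E) \<longleftrightarrow> E \<inter> set z = P1 z \<or> E \<inter> set z = P2 z"
    if "z \<in> ?C" for z E
  proof -
    obtain e where e: "e \<in> pairs n" "z = support ?p e" using C[OF \<open>z \<in> ?C\<close>] by blast
    show "P1 z \<inter> P2 z = {}" using P1_P2_support_disjoint[OF p E0] e by blast
    have "e = (?p ^^ 0) e \<and> 0 < least_power ?p e \<and> even (0::nat)"
      using least_power_of_permutation[OF perm] by simp
    then have "e \<in> P1 z" unfolding e(2) P1_support by blast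
    then show "P1 z \<noteq> {}" by blast
    show "(\<forall>y\<in>set z. ?p y \<in> E \<longleftrightarrow> y \<notin> E) \<longleftrightarrow> E \<inter> set z = P1 z \<or> E \<inter> set z = P2 z"
      using complementing_on_cycle_iff[OF p perm E0 e(1)] e(2) by blast
  qed
  have iff: "(\<forall>z\<in>?C. E \<inter> set z = P1 z \<or> E \<inter> set z = P2 z) \<longleftrightarrow>
      act \<alpha> (verts n, E) = complement (verts n, E)" if "E \<subseteq> pairs n" for E
  proof -
    have "(\<forall>z\<in>?C. E \<inter> set z = P1 z \<or> E \<inter> set z = P2 z) \<longleftrightarrow>
        (\<forall>z\<in>?C. \<forall>y\<in>set z. ?p y \<in> E \<longleftrightarrow> y \<notin> E)"
      using cyc(3) by blast
    also have "\<dots> \<longleftrightarrow> (\<forall>y\<in>pairs n. ?p y \<in> E \<longleftrightarrow> y \<notin> E)"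
      using union unfolding P1_P2_set by blast
    finally show ?thesis using act_eq_complement_iff[OF a that] by blast
  qed
  have "U_perm n \<alpha> = (\<Sum>E | E \<subseteq> pairs n \<and> (\<forall>z\<in>?C. E \<inter> (P1 z \<union> P2 z) = P1 z \<or> E \<inter> (P1 z \<union> P2 z) = P2 z).
      monom 1 (sum (weight n) E))"
    unfolding U_perm_def W1_def W2_def
    using prod_monom_add_eq_sum_sets[OF finC finite_verts_pairs(2) union, of "weight n"] disj cyc
    unfolding P1_P2_set by blast
  also have "\<dots> = (\<Sum>E | E \<subseteq> pairs n \<and> act \<alpha> (verts n, E) = complement (verts n, E). monom 1 (sum (weight n) E))"
    unfolding P1_P2_set using iff by (intro sum.cong) auto
  finally show ?thesis .
qed

section \<open>Counting the permutations that complement a graph\<close>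

text \<open>Left composition with one fixed complementing \<open>\<sigma>\<close> carries
  automorphisms to complementing permutations, and \<open>inv \<sigma>\<close> carries them
  back.\<close>

lemma card_complementing_eq_card_aut:
  assumes G: "G \<in> sc_graphs n"
  shows "card {\<alpha> \<in> sym_grp n. act \<alpha> G = complement G} = card (aut_grp n G)"
proof -
  obtain E where E: "G = (verts n, E)" "E \<subseteq> pairs n"
    using G by (auto simp: sc_graphs_def lgraphs_def)
  obtain \<sigma> where \<sigma>: "\<sigma> permutes verts n" "act \<sigma> G = complement G"
    using G by (auto simp: sc_graphs_def sym_grp_def)
  have inv: "inv \<sigma> permutes verts n" using permutes_inv[OF \<sigma>(1)] .
  have comp: "act (\<tau> \<circ> \<rho>) G = act \<tau> (act \<rho> G)" if "\<rho> permutes verts n" for \<tau> \<rho>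
    using act_comp[OF E(2) that] E(1) by simp
  have actid: "act id G = G" using act_eq[OF E(2), of id] E(1) by simp
  have "bij_betw (\<lambda>\<tau>. \<sigma> \<circ> \<tau>) (aut_grp n G) {\<alpha> \<in> sym_grp n. act \<alpha> G = complement G}"
  proof (rule bij_betwI[where g = "\<lambda>\<tau>. inv \<sigma> \<circ> \<tau>"])
    show "(\<circ>) \<sigma> \<in> aut_grp n G \<rightarrow> {\<alpha> \<in> sym_grp n. act \<alpha> G = complement G}"
      using \<sigma> comp by (auto simp: aut_grp_def sym_grp_def intro: permutes_compose)
    show "(\<circ>) (inv \<sigma>) \<in> {\<alpha> \<in> sym_grp n. act \<alpha> G = complement G} \<rightarrow> aut_grp n G"
    proof
      fix \<tau> assume "\<tau> \<in> {\<alpha> \<in> sym_grp n. act \<alpha> G = complement G}"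
      then have \<tau>: "\<tau> permutes verts n" "act \<tau> G = act \<sigma> G" using \<sigma> by (auto simp: sym_grp_def)
      have "act (inv \<sigma> \<circ> \<tau>) G = act (inv \<sigma> \<circ> \<sigma>) G"
        using comp[OF \<tau>(1)] comp[OF \<sigma>(1)] \<tau>(2) by simp
      then show "inv \<sigma> \<circ> \<tau> \<in> aut_grp n G"
        using actid permutes_inv_o[OF \<sigma>(1)] permutes_compose[OF \<tau>(1) inv]
        by (simp add: aut_grp_def sym_grp_def)
    qed
    show "inv \<sigma> \<circ> (\<sigma> \<circ> \<tau>) = \<tau>" "\<sigma> \<circ> (inv \<sigma> \<circ> \<tau>) = \<tau>" for \<tau>
      using permutes_inv_o[OF \<sigma>(1)] by (simp_all add: o_assoc)
  qed
  then show ?thesis by (rule bij_betw_same_card[symmetric])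
qed

section \<open>The coefficients of \<open>U n\<close>\<close>

lemma finite_sc_perms: "finite (sc_perms n)"
  by (rule finite_subset[of _ "{\<alpha>. \<alpha> permutes verts n}"])
    (auto simp: sc_perms_def sym_grp_def finite_permutations)

lemma coeff_U:
  "coeff (U n) L = (\<Sum>\<alpha>\<in>sc_perms n.
    card {E. E \<subseteq> pairs n \<and> act \<alpha> (verts n, E) = complement (verts n, E) \<and> sum (weight n) E = L})"
proof -
  have "coeff (U_perm n \<alpha>) L =
      card {E. E \<subseteq> pairs n \<and> act \<alpha> (verts n, E) = complement (verts n, E) \<and> sum (weight n) E = L}"
    if "\<alpha> \<in> sc_perms n" for \<alpha>
  proof -
    let ?A = "{E. E \<subseteq> pairs n \<and> act \<alpha> (verts n, E) = complement (verts n, E)}"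
    have fin: "finite ?A" by (rule finite_subset[of _ "Pow (pairs n)"]) auto
    have "coeff (U_perm n \<alpha>) L = (\<Sum>E\<in>?A. if sum (weight n) E = L then 1 else 0)"
      by (simp add: U_perm_eq_sum[OF that] coeff_sum) (simp only: One_nat_def)
    also have "\<dots> = card {E \<in> ?A. sum (weight n) E = L}"
      using fin by (simp add: sum.If_cases Int_def)
    finally show ?thesis by (simp add: conj_assoc)
  qed
  then show ?thesis by (simp add: U_def coeff_sum)
qed

text \<open>Since the total weight determines the edge set, each \<open>\<alpha>\<close> contributes
  1 if it complements this very graph and 0 otherwise. Restricting to \<open>sc_perms n\<close>
  loses none of these permutations when the graph is self-complementary.\<close>

lemma coeff_U_sum_weight:
  assumes E: "E \<subseteq> pairs n"
  shows "coeff (U n) (sum (weight n) E) =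
    (if (verts n, E) \<in> sc_graphs n then card (aut_grp n (verts n, E)) else 0)"
proof -
  let ?G = "(verts n, E)"
  have "D = E" if "D \<subseteq> pairs n" "sum (weight n) D = sum (weight n) E" for D
    using inj_onD[OF inj_on_sum_weight that(2)] that E by simp
  then have "{D. D \<subseteq> pairs n \<and> act \<alpha> (verts n, D) = complement (verts n, D) \<and> sum (weight n) D = sum (weight n) E}
      = (if act \<alpha> ?G = complement ?G then {E} else {})" for \<alpha>
    using E by auto
  then have "coeff (U n) (sum (weight n) E) = (\<Sum>\<alpha>\<in>sc_perms n. if act \<alpha> ?G = complement ?G then 1 else 0)"
    unfolding coeff_U by (intro sum.cong) auto
  also have "\<dots> = card {\<alpha> \<in> sc_perms n. act \<alpha> ?G = complement ?G}"
    using finite_sc_perms by (simp add: sum.If_cases Int_def)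
  also have "\<dots> = (if ?G \<in> sc_graphs n then card (aut_grp n ?G) else 0)"
  proof (cases "?G \<in> sc_graphs n")
    case True
    then have "{\<alpha> \<in> sc_perms n. act \<alpha> ?G = complement ?G} = {\<alpha> \<in> sym_grp n. act \<alpha> ?G = complement ?G}"
      by (auto simp: sc_perms_def)
    then show ?thesis using True card_complementing_eq_card_aut by simp
  next
    case False
    then have "{\<alpha> \<in> sc_perms n. act \<alpha> ?G = complement ?G} = {}"
      using E by (auto simp: sc_perms_def sc_graphs_def lgraphs_def)
    then show ?thesis using False by (metis card.empty)
  qed
  finally show ?thesis .
qed

text \<open>Needed for surjectivity: it provides the candidate graph for an exponent that is known
  only through its coefficient.\<close>

lemma coeff_U_nonzeroE:
  assumes "coeff (U n) L \<noteq> 0"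
  obtains E where "E \<subseteq> pairs n" "L = sum (weight n) E"
proof -
  from assms obtain \<alpha> where
    "card {E. E \<subseteq> pairs n \<and> act \<alpha> (verts n, E) = complement (verts n, E) \<and> sum (weight n) E = L} \<noteq> 0"
    unfolding coeff_U by (meson sum.neutral)
  then obtain E where "E \<subseteq> pairs n" "sum (weight n) E = L"
    by (metis (mono_tags, lifting) card.empty Collect_empty_eq)
  then show ?thesis using that by blast
qed

theorem theorem11:
  fixes n \<xi> :: nat
  assumes "n \<ge> 4"
    and "n mod 4 = 0 \<or> n mod 4 = 1"
    and "\<xi> \<in> coeff_values n"
  shows "lsc n \<xi> = card (levels n \<xi>)"
proof -
  let ?S = "{G \<in> sc_graphs n. card (aut_grp n G) = \<xi>}"
  let ?w = "\<lambda>G. sum (weight n) (snd G)"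
  \<comment> \<open>Zero is the coefficient at all but finitely many exponents; excluding it
    confines \<open>levels n \<xi>\<close> to weights of edge sets.\<close>
  have pos: "\<xi> \<noteq> 0" using assms(3) by (auto simp: coeff_values_def)
  have graph: "G = (verts n, snd G) \<and> snd G \<subseteq> pairs n" if "G \<in> sc_graphs n" for G
    using that by (auto simp: sc_graphs_def lgraphs_def)
  have "bij_betw ?w ?S (levels n \<xi>)"
    unfolding bij_betw_def
  proof
    show "inj_on ?w ?S"
    proof (rule inj_onI)
      fix G H assume GH: "G \<in> ?S" "H \<in> ?S" "?w G = ?w H"
      then have "snd G = snd H"
        using inj_onD[OF inj_on_sum_weight GH(3)] graph by blast
      then show "G = H" using graph GH by (metis (lifting) mem_Collect_eq)
    qed
    show "?w ` ?S = levels n \<xi>"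
    proof (intro equalityI subsetI)
      fix L assume "L \<in> ?w ` ?S"
      then obtain G where G: "G \<in> sc_graphs n" "card (aut_grp n G) = \<xi>" "L = ?w G" by blast
      then show "L \<in> levels n \<xi>"
        using coeff_U_sum_weight[of "snd G" n] graph[OF G(1)] by (simp add: levels_def)
    next
      fix L assume "L \<in> levels n \<xi>"
      then have L: "coeff (U n) L = \<xi>" by (simp add: levels_def)
      then obtain E where E: "E \<subseteq> pairs n" "L = sum (weight n) E"
        using pos coeff_U_nonzeroE by metis
      \<comment> \<open>As \<open>\<xi>\<close> is nonzero, the zero branch of
        \<open>coeff_U_sum_weight\<close> is impossible, so the graph is self-complementary.\<close>
      then have "(verts n, E) \<in> ?S"
        using coeff_U_sum_weight[OF E(1)] L pos by (auto split: if_splits)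
      then show "L \<in> ?w ` ?S" using E(2) by force
    qed
  qed
  then show ?thesis unfolding lsc_def by (rule bij_betw_same_card)
qed

end
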